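(* Let $M$ be a real smooth, of class $C^1$, differentiable manifold, let $L$ be a flat linear transport over $M$, smooth of class $C^1$, and let $\nabla^L$ be the linear connection generated by $L$. Then the parallel transport defined by $\nabla^L$ coincides with $L$: for every $C^1$ path $\gamma:J\to M$, $J\subset\mathbb{R}$, all $s,t\in J$ and every tensor type $(p,q)$, the parallel transport ${}^{L}P^{\gamma}_{\gamma(s),\gamma(t)}:T^{p,q}_{\gamma(s)}(M)\to T^{p,q}_{\gamma(t)}(M)$ of $\nabla^L$ along $\gamma$ equals $L_{\gamma(s)\to\gamma(t)}$ on $T^{p,q}_{\gamma(s)}(M)$.
   Context: $T^{p,q}_x(M)$ is the space of tensors of type $(p,q)$ at $x\in M$. A flat linear transport (of tensors) over $M$ is a map $L:(x,y)\mapsto L_{x\to y}$, $x,y\in M$, where $L_{x\to y}$ maps the tensor algebra at $x$ into the tensor algebra at $y$, such that for all $x,y,z\in M$ and all types: (i) $L_{x\to y}(T^{p,q}_x(M))\subseteq T^{p,q}_y(M)$; (ii) $L_{x\to y}$ is linear on each $T^{p,q}_x(M)$; (iii) $L_{x\to y}(A_1\otimes A_2)=(L_{x\to y}A_1)\otimes(L_{x\to y}A_2)$; (iv) $L_{x\to y}\circ C=C\circ L_{x\to y}$ for every contraction operator $C$; (v) $L_{y\to z}\circ L_{x\to y}=L_{x\to z}$; (vi) $L_{x\to x}=\mathrm{id}$. For a field of bases $\{E_i\}$ of the tangent spaces with dual bases $\{E^i\}$, write $L_{x\to y}(E_j(x))=H^{i}{}_{j}(y,x)E_i(y)$ (summation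 over repeated indices); $L$ is smooth of class $C^1$ if the bivector $H(y,x)=H^{i}{}_{j}(y,x)E_i(y)\otimes E^j(x)$ and its inverse bivector are of class $C^1$. The linear connection generated by $L$ is $\nabla^L:V\mapsto\nabla^L_V$, $(\nabla^L_VS)(x):=\lim_{\varepsilon\to0}\frac1\varepsilon\bigl(L_{x_\varepsilon\to x}S(x_\varepsilon)-S(x)\bigr)$ for vector fields $V$ and $C^1$ tensor fields $S$, where in some local coordinates around $x$ the point $x_\varepsilon$ has coordinates $x^i+\varepsilon V^i|_x$, $V|_x=V^i|_x\,\partial/\partial x^i$. The parallel transport of a connection $\nabla$ along a $C^1$ path $\gamma$ is the map $P^\gamma_{\gamma(s),\gamma(t)}(A_0):=B_{\gamma(t)}$ for $A_0\in T^{p,q}_{\gamma(s)}(M)$, where the tensor field $B$ along $\gamma$ is defined by the initial-value problem $\nabla_{\dot\gamma}B=0$, $B_{\gamma(s)}=A_0$, with $\dot\gamma$ the tangent vector field of $\gamma$. *)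

theory Defs
  imports "HOL-Analysis.Analysis"
begin

section \<open>Maps of class \<open>C\<^sup>1\<close>\<close>

definition C1_on :: "'e::real_normed_vector set \<Rightarrow> ('e \<Rightarrow> 'f::real_normed_vector) \<Rightarrow> bool" where
  "C1_on U f \<longleftrightarrow>
     (\<exists>f'. (\<forall>u\<in>U. (f has_derivative blinfun_apply (f' u)) (at u)) \<and> continuous_on U f')"

text \<open>One-sided derivatives at the end points of \<open>J\<close>; \<open>T\<close> is relatively open in \<open>J\<close>.\<close>

definition C1_within :: "real set \<Rightarrow> real set \<Rightarrow> (real \<Rightarrow> 'f::real_normed_vector) \<Rightarrow> bool" where
  "C1_within J T f \<longleftrightarrow>
     (\<exists>f'. (\<forall>t\<in>T. (f has_vector_derivative f' t) (at t within J)) \<and> continuous_on T f')"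


section \<open>Manifolds of class \<open>C\<^sup>1\<close>\<close>

text \<open>The manifold is the whole type \<open>'a\<close>; its dimension is \<open>CARD('n)\<close>. In a chart \<open>(U, \<phi>)\<close> the
  values of \<open>\<phi>\<close> outside \<open>U\<close> are irrelevant.\<close>

type_synonym ('a, 'n) chart = "'a set \<times> ('a \<Rightarrow> real ^ 'n)"

definition chart_inv :: "('a, 'n) chart \<Rightarrow> real ^ 'n \<Rightarrow> 'a" where
  "chart_inv c = inv_into (fst c) (snd c)"

definition C1_manifold :: "('a::topological_space, 'n::finite) chart set \<Rightarrow> bool" where
  "C1_manifold A \<longleftrightarrow>
     (\<Union>c\<in>A. fst c) = UNIV \<and>
     (\<forall>c\<in>A. open (fst c) \<and> open (snd c ` fst c) \<and>
        homeomorphism (fst c) (snd c ` fst c) (snd c) (chart_inv c)) \<and>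
     (\<forall>c\<in>A. \<forall>d\<in>A. C1_on (snd c ` (fst c \<inter> fst d)) (snd d \<circ> chart_inv c))"

definition charts_at :: "('a, 'n) chart set \<Rightarrow> 'a \<Rightarrow> ('a, 'n) chart set" where
  "charts_at A x = {c \<in> A. x \<in> fst c}"

text \<open>\<open>jac c d x $ i $ j\<close> is \<open>\<partial>x\<^sub>d\<^sup>i / \<partial>x\<^sub>c\<^sup>j\<close> at \<open>x\<close>.\<close>

definition jac :: "('a, 'n::finite) chart \<Rightarrow> ('a, 'n) chart \<Rightarrow> 'a \<Rightarrow> real ^ 'n ^ 'n" where
  "jac c d x = jacobian (snd d \<circ> chart_inv c) (at (snd c x))"


section \<open>Tensors\<close>

text \<open>A tensor of type \<open>(p, q)\<close> at \<open>x\<close> is given by its components in the charts around \<open>x\<close>,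
  subject to the tensor transformation law: \<open>S c I J\<close> is the component, in the chart \<open>c\<close>, with the
  list \<open>I\<close> of \<open>p\<close> upper indices and the list \<open>J\<close> of \<open>q\<close> lower indices. All other values of \<open>S\<close> are \<open>0\<close>,
  so that equality of tensors is equality of functions. Tangent vectors are the tensors of
  type \<open>(1, 0)\<close> and covectors those of type \<open>(0, 1)\<close>.\<close>

type_synonym ('a, 'n) tensor = "('a, 'n) chart \<Rightarrow> 'n list \<Rightarrow> 'n list \<Rightarrow> real"

text \<open>The coefficient of the \<open>c\<close>-component \<open>(K, M)\<close> in the \<open>d\<close>-component \<open>(I, J)\<close>.\<close>

definition transition_coeff ::
  "('a, 'n::finite) chart \<Rightarrow> ('a, 'n) chart \<Rightarrow> 'a \<Rightarrow> 'n list \<Rightarrow> 'n list \<Rightarrow> 'n list \<Rightarrow> 'n list \<Rightarrow> real"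
  where
  "transition_coeff c d x K M I J =
     (\<Prod>r<length I. jac c d x $ (I ! r) $ (K ! r)) *
     (\<Prod>s<length J. jac d c x $ (M ! s) $ (J ! s))"

definition tensors_at ::
  "('a, 'n::finite) chart set \<Rightarrow> 'a \<Rightarrow> nat \<Rightarrow> nat \<Rightarrow> ('a, 'n) tensor set" where
  "tensors_at A x p q = {S.
     (\<forall>c I J. c \<notin> charts_at A x \<or> length I \<noteq> p \<or> length J \<noteq> q \<longrightarrow> S c I J = 0) \<and>
     (\<forall>c\<in>charts_at A x. \<forall>d\<in>charts_at A x. \<forall>I J. length I = p \<longrightarrow> length J = q \<longrightarrow>
        S d I J = (\<Sum>K | length K = p. \<Sum>M | length M = q. transition_coeff c d x K M I J * S c K M))}"

text \<open>The coordinate basis tensor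
  \<open>\<partial>/\<partial>x\<^sup>k\<^sup>1 \<otimes> \<dots> \<otimes> \<partial>/\<partial>x\<^sup>k\<^sup>p \<otimes> dx\<^sup>m\<^sup>1 \<otimes> \<dots> \<otimes> dx\<^sup>m\<^sup>q\<close> of the chart \<open>c\<close>, as a function of the point;
  it is extended by \<open>0\<close> outside the domain of \<open>c\<close>.\<close>

definition coord_tensor ::
  "('a, 'n::finite) chart set \<Rightarrow> ('a, 'n) chart \<Rightarrow> 'n list \<Rightarrow> 'n list \<Rightarrow> 'a \<Rightarrow> ('a, 'n) tensor" where
  "coord_tensor A c K M x = (\<lambda>d I J.
     if x \<in> fst c \<and> d \<in> charts_at A x \<and> length I = length K \<and> length J = length M
     then transition_coeff c d x K M I J else 0)"

abbreviation coord_vector ::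
  "('a, 'n::finite) chart set \<Rightarrow> ('a, 'n) chart \<Rightarrow> 'n \<Rightarrow> 'a \<Rightarrow> ('a, 'n) tensor" where
  "coord_vector A c k \<equiv> coord_tensor A c [k] []"

lemma tensor_expansion:
  assumes "S \<in> tensors_at A x p q" and "c \<in> charts_at A x"
  shows "S = (\<lambda>d I J. \<Sum>K | length K = p. \<Sum>M | length M = q. S c K M * coord_tensor A c K M x d I J)"
proof (intro ext)
  fix d I J
  show "S d I J = (\<Sum>K | length K = p. \<Sum>M | length M = q. S c K M * coord_tensor A c K M x d I J)"
  proof (cases "d \<in> charts_at A x \<and> length I = p \<and> length J = q")
    case True
    with assms have "S d I J =
      (\<Sum>K | length K = p. \<Sum>M | length M = q. transition_coeff c d x K M I J * S c K M)"
      unfolding tensors_at_def by blast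
    also have "\<dots> = (\<Sum>K | length K = p. \<Sum>M | length M = q. S c K M * coord_tensor A c K M x d I J)"
      using True assms(2) by (intro sum.cong refl) (auto simp: coord_tensor_def charts_at_def)
    finally show ?thesis .
  next
    case False
    with assms have "S d I J = 0"
      unfolding tensors_at_def by blast
    moreover have "(\<Sum>K | length K = p. \<Sum>M | length M = q. S c K M * coord_tensor A c K M x d I J) = 0"
      using False by (intro sum.neutral ballI) (auto simp: coord_tensor_def)
    ultimately show ?thesis by simp
  qed
qed

definition tensor_lincomb ::
  "real \<Rightarrow> ('a, 'n) tensor \<Rightarrow> real \<Rightarrow> ('a, 'n) tensor \<Rightarrow> ('a, 'n) tensor" where
  "tensor_lincomb a S b T = (\<lambda>c I J. a * S c I J + b * T c I J)"

text \<open>The product of \<open>S\<close>, of type \<open>(p, q)\<close>, with a tensor \<open>T\<close> of any type.\<close>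

definition tensor_prod ::
  "nat \<Rightarrow> nat \<Rightarrow> ('a, 'n) tensor \<Rightarrow> ('a, 'n) tensor \<Rightarrow> ('a, 'n) tensor" where
  "tensor_prod p q S T = (\<lambda>c I J. S c (take p I) (take q J) * T c (drop p I) (drop q J))"

text \<open>Contraction of the upper index at position \<open>r\<close> with the lower index at position \<open>s\<close>, both
  counted from \<open>0\<close>.\<close>

definition contraction :: "nat \<Rightarrow> nat \<Rightarrow> ('a, 'n::finite) tensor \<Rightarrow> ('a, 'n) tensor" where
  "contraction r s S = (\<lambda>c I J. \<Sum>k\<in>UNIV. S c (take r I @ k # drop r I) (take s J @ k # drop s J))"


section \<open>Flat linear transports\<close>

text \<open>\<open>L x y\<close> is the transport from \<open>x\<close> to \<open>y\<close>.\<close>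

definition flat_linear_transport ::
  "('a, 'n::finite) chart set \<Rightarrow> ('a \<Rightarrow> 'a \<Rightarrow> ('a, 'n) tensor \<Rightarrow> ('a, 'n) tensor) \<Rightarrow> bool" where
  "flat_linear_transport A L \<longleftrightarrow>
     (\<forall>x y p q. \<forall>S\<in>tensors_at A x p q. L x y S \<in> tensors_at A y p q) \<and>
     (\<forall>x y p q a b. \<forall>S\<in>tensors_at A x p q. \<forall>T\<in>tensors_at A x p q.
        L x y (tensor_lincomb a S b T) = tensor_lincomb a (L x y S) b (L x y T)) \<and>
     (\<forall>x y p q p' q'. \<forall>S\<in>tensors_at A x p q. \<forall>T\<in>tensors_at A x p' q'.
        L x y (tensor_prod p q S T) = tensor_prod p q (L x y S) (L x y T)) \<and>
     (\<forall>x y p q. \<forall>r\<le>p. \<forall>s\<le>q. \<forall>S\<in>tensors_at A x (Suc p) (Suc q).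
        L x y (contraction r s S) = contraction r s (L x y S)) \<and>
     (\<forall>x y z p q. \<forall>S\<in>tensors_at A x p q. L y z (L x y S) = L x z S) \<and>
     (\<forall>x p q. \<forall>S\<in>tensors_at A x p q. L x x S = S)"

text \<open>The matrix \<open>H\<^sup>i\<^sub>j(y, x)\<close> defined by \<open>L\<^sub>x\<^sub>\<rightarrow>\<^sub>y (E\<^sub>j(x)) = H\<^sup>i\<^sub>j(y, x) E\<^sub>i(y)\<close>, where the bases are the
  coordinate bases of \<open>d\<close> at \<open>x\<close> and of \<open>c\<close> at \<open>y\<close> (compare \<open>tensor_expansion\<close>). As \<open>c\<close> and \<open>d\<close> vary,
  these are the components of the bivector \<open>H(y, x)\<close>, an element of the tensor product of the
  tangent space at \<open>y\<close> and the cotangent space at \<open>x\<close>.\<close>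

definition transport_matrix ::
  "('a, 'n::finite) chart set \<Rightarrow> ('a \<Rightarrow> 'a \<Rightarrow> ('a, 'n) tensor \<Rightarrow> ('a, 'n) tensor) \<Rightarrow>
   ('a, 'n) chart \<Rightarrow> ('a, 'n) chart \<Rightarrow> 'a \<Rightarrow> 'a \<Rightarrow> real ^ 'n ^ 'n" where
  "transport_matrix A L c d y x = (\<chi> i j. L x y (coord_vector A d j x) c [i] [])"

text \<open>A bivector is of class \<open>C\<^sup>1\<close> if its components in the charts of the atlas are, jointly in
  both points. Since \<open>A\<close> is a given atlas rather than a maximal \<open>C\<^sup>1\<close> atlas, this is satisfiable; it is
  independent of the charts for an atlas of class \<open>C\<^sup>2\<close>.\<close>

definition C1_transport ::
  "('a, 'n::finite) chart set \<Rightarrow> ('a \<Rightarrow> 'a \<Rightarrow> ('a, 'n) tensor \<Rightarrow> ('a, 'n) tensor) \<Rightarrow> bool" where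
  "C1_transport A L \<longleftrightarrow>
     (\<forall>c\<in>A. \<forall>d\<in>A.
        C1_on (snd c ` fst c \<times> snd d ` fst d)
          (\<lambda>(v, u). transport_matrix A L c d (chart_inv c v) (chart_inv d u)) \<and>
        C1_on (snd c ` fst c \<times> snd d ` fst d)
          (\<lambda>(v, u). matrix_inv (transport_matrix A L c d (chart_inv c v) (chart_inv d u))))"


section \<open>The connection generated by a transport\<close>

text \<open>A connection maps a vector field \<open>V\<close> and a tensor field \<open>S\<close> to the tensor field \<open>\<nabla>\<^sub>V S\<close>. Fields are
  total functions, but only the values of \<open>V\<close> and \<open>S\<close> near \<open>x\<close> matter for \<open>\<nabla>\<^sub>V S\<close> at \<open>x\<close>, so that
  a connection also applies to fields, such as \<open>coord_tensor A c K M\<close>, that are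
  meaningful on an open set only.\<close>

type_synonym ('a, 'n) field = "'a \<Rightarrow> ('a, 'n) tensor"

type_synonym ('a, 'n) connection = "('a, 'n) field \<Rightarrow> ('a, 'n) field \<Rightarrow> ('a, 'n) field"

text \<open>The point \<open>x\<^sub>\<epsilon>\<close> is taken in some chart \<open>c\<close> around \<open>x\<close>. The limit is taken in the
  finite-dimensional space of tensors at \<open>x\<close>, that is, componentwise.\<close>

definition generated_connection ::
  "('a, 'n::finite) chart set \<Rightarrow> ('a \<Rightarrow> 'a \<Rightarrow> ('a, 'n) tensor \<Rightarrow> ('a, 'n) tensor) \<Rightarrow>
   ('a, 'n) connection" where
  "generated_connection A L V S x =
     (let c = (SOME c. c \<in> charts_at A x);
          x\<^sub>\<epsilon> = (\<lambda>\<epsilon>::real. chart_inv c (snd c x + \<epsilon> *\<^sub>R (\<chi> i. V x c [i] [])))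
      in (\<lambda>d I J. Lim (at 0) (\<lambda>\<epsilon>. (1 / \<epsilon>) * (L (x\<^sub>\<epsilon> \<epsilon>) x (S (x\<^sub>\<epsilon> \<epsilon>)) d I J - S x d I J))))"


section \<open>Parallel transport of a connection\<close>

text \<open>Degenerate intervals are excluded, as derivatives make no sense there.\<close>

definition C1_path ::
  "('a::topological_space, 'n::finite) chart set \<Rightarrow> real set \<Rightarrow> (real \<Rightarrow> 'a) \<Rightarrow> bool" where
  "C1_path A J \<gamma> \<longleftrightarrow>
     is_interval J \<and> interior J \<noteq> {} \<and> continuous_on J \<gamma> \<and>
     (\<forall>c\<in>A. C1_within J {t \<in> J. \<gamma> t \<in> fst c} (snd c \<circ> \<gamma>))"

text \<open>Fields along \<open>\<gamma>\<close> depend on the parameter, as \<open>\<gamma>\<close> need not be injective.\<close>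

definition C1_tensor_field_along ::
  "('a, 'n::finite) chart set \<Rightarrow> real set \<Rightarrow> (real \<Rightarrow> 'a) \<Rightarrow> nat \<Rightarrow> nat \<Rightarrow>
   (real \<Rightarrow> ('a, 'n) tensor) \<Rightarrow> bool" where
  "C1_tensor_field_along A J \<gamma> p q B \<longleftrightarrow>
     (\<forall>t\<in>J. B t \<in> tensors_at A (\<gamma> t) p q) \<and>
     (\<forall>c\<in>A. \<forall>I J'. length I = p \<longrightarrow> length J' = q \<longrightarrow>
        C1_within J {t \<in> J. \<gamma> t \<in> fst c} (\<lambda>t. B t c I J'))"

definition velocity ::
  "real set \<Rightarrow> (real \<Rightarrow> 'a) \<Rightarrow> ('a, 'n::finite) chart \<Rightarrow> real \<Rightarrow> real ^ 'n" where
  "velocity J \<gamma> c t = vector_derivative (snd c \<circ> \<gamma>) (at t within J)"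

text \<open>The covariant derivative \<open>\<nabla>\<^sub>\<gamma>\<^sub>' B\<close> of a field \<open>B\<close> along \<open>\<gamma>\<close> induced by a connection, evaluated
  with the help of a chart \<open>c\<close> around \<open>\<gamma>(t)\<close>. One expands \<open>B = \<Sum> B\<^sup>K\<^sub>M E\<^sub>K\<^sup>M\<close> in the
  coordinate basis tensors and uses the Leibniz rule
  \<open>\<nabla>\<^sub>\<gamma>\<^sub>' B = \<Sum> (dB\<^sup>K\<^sub>M/dt) E\<^sub>K\<^sup>M + B\<^sup>K\<^sub>M \<gamma>'\<^sup>k \<nabla>\<^sub>k E\<^sub>K\<^sup>M\<close>, with \<open>\<nabla>\<^sub>k\<close> the derivative along \<open>\<partial>/\<partial>x\<^sup>k\<close>.\<close>

definition cov_deriv_along ::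
  "('a, 'n::finite) chart set \<Rightarrow> ('a, 'n) connection \<Rightarrow> real set \<Rightarrow> (real \<Rightarrow> 'a) \<Rightarrow> nat \<Rightarrow> nat \<Rightarrow>
   ('a, 'n) chart \<Rightarrow> (real \<Rightarrow> ('a, 'n) tensor) \<Rightarrow> real \<Rightarrow> ('a, 'n) tensor" where
  "cov_deriv_along A nabla J \<gamma> p q c B t = (\<lambda>d I J'.
     \<Sum>K | length K = p. \<Sum>M | length M = q.
       vector_derivative (\<lambda>u. B u c K M) (at t within J) * coord_tensor A c K M (\<gamma> t) d I J' +
       B t c K M * (\<Sum>k\<in>UNIV. velocity J \<gamma> c t $ k *
                      nabla (coord_vector A c k) (coord_tensor A c K M) (\<gamma> t) d I J'))"

definition parallel_along ::
  "('a, 'n::finite) chart set \<Rightarrow> ('a, 'n) connection \<Rightarrow> real set \<Rightarrow> (real \<Rightarrow> 'a) \<Rightarrow> nat \<Rightarrow> nat \<Rightarrow>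
   (real \<Rightarrow> ('a, 'n) tensor) \<Rightarrow> bool" where
  "parallel_along A nabla J \<gamma> p q B \<longleftrightarrow>
     C1_tensor_field_along A J \<gamma> p q B \<and>
     (\<forall>t\<in>J. \<forall>c\<in>charts_at A (\<gamma> t). cov_deriv_along A nabla J \<gamma> p q c B t = (\<lambda>d I J'. 0))"

text \<open>The value at \<open>t\<close> of the parallel field along \<open>\<gamma>\<close> with value \<open>S\<^sub>0\<close> at \<open>s\<close>.\<close>

definition parallel_transport ::
  "('a, 'n::finite) chart set \<Rightarrow> ('a, 'n) connection \<Rightarrow> real set \<Rightarrow> (real \<Rightarrow> 'a) \<Rightarrow> nat \<Rightarrow> nat \<Rightarrow>
   real \<Rightarrow> real \<Rightarrow> ('a, 'n) tensor \<Rightarrow> ('a, 'n) tensor" where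
  "parallel_transport A nabla J \<gamma> p q s t S\<^sub>0 =
     (THE S. \<exists>B. parallel_along A nabla J \<gamma> p q B \<and> B s = S\<^sub>0 \<and> S = B t)"

end

theory Submission
  imports Defs
begin

text \<open>A flat transport identifies all the tensor spaces of \<open>M\<close> with each other, compatibly with
  composition, and the point is that \<open>\<nabla>\<^sup>L\<close> is ordinary differentiation under this identification.
  If \<open>B\<close> is a \<open>C\<^sup>1\<close> tensor field along a path \<open>\<gamma>\<close>, then \<open>u \<mapsto> L\<^bsub>\<gamma>(u)\<rightarrow>\<gamma>(t)\<^esub> B\<^sub>u\<close> is a curve in the
  fixed vector space of tensors at \<open>\<gamma>(t)\<close>, and its derivative at \<open>u = t\<close> is \<open>\<nabla>\<^sup>L\<^bsub>\<gamma>'\<^esub> B\<close> at \<open>t\<close>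
  (\<open>has_vector_derivative_pull_back\<close>). Both halves of the theorem follow from this one formula.

  Existence: for \<open>B\<^sub>u = L\<^bsub>\<gamma>(s)\<rightarrow>\<gamma>(u)\<^esub> S\<close> flatness makes the pulled-back curve constant, namely equal to
  \<open>L\<^bsub>\<gamma>(s)\<rightarrow>\<gamma>(t)\<^esub> S\<close>, so that \<open>B\<close> is parallel (\<open>transported_parallel_along\<close>).

  Uniqueness: for a parallel \<open>B\<close>, the curve \<open>u \<mapsto> L\<^bsub>\<gamma>(u)\<rightarrow>\<gamma>(s)\<^esub> B\<^sub>u\<close> is, for every \<open>t\<close>, the image
  of \<open>u \<mapsto> L\<^bsub>\<gamma>(u)\<rightarrow>\<gamma>(t)\<^esub> B\<^sub>u\<close> under the fixed linear map \<open>L\<^bsub>\<gamma>(t)\<rightarrow>\<gamma>(s)\<^esub>\<close>, so its derivative vanishes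
  everywhere and it is constant, equal to \<open>B\<^sub>s\<close> (\<open>parallel_along_eq_transport\<close>).

  The formula itself is a product rule in the expansion of \<open>B\<close> in coordinate tensors. It needs
  \<open>y \<mapsto> L\<^bsub>y\<rightarrow>x\<^esub> E\<^sub>K\<^sup>M(y)\<close> to be differentiable, while smoothness of \<open>L\<close> is only a statement on tangent
  vectors, through the matrix \<open>H\<close>. Compatibility with products and contractions closes this gap:
  the transport of \<open>E\<^sub>K\<^sup>M\<close> has as components products of entries of \<open>H(y, x)\<close> and of its inverse
  \<open>H(x, y)\<close> (\<open>transport_coord_tensor\<close>).\<close>

section \<open>Calculus of maps of class \<open>C\<^sup>1\<close>\<close>

lemma C1_onI:
  assumes "\<And>u. u \<in> U \<Longrightarrow> (f has_derivative blinfun_apply (f' u)) (at u)"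
    and "continuous_on U f'"
  shows "C1_on U f"
  using assms unfolding C1_on_def by blast

lemma C1_on_imp_continuous_on:
  assumes "C1_on U f"
  shows "continuous_on U f"
  using assms unfolding C1_on_def
  by (meson continuous_at_imp_continuous_on has_derivative_continuous)

lemma C1_on_const: "C1_on U (\<lambda>u. a)"
  by (rule C1_onI[where f' = "\<lambda>u. 0"]) (auto simp: zero_blinfun.rep_eq)

lemma C1_on_cong:
  assumes "open U" "\<And>u. u \<in> U \<Longrightarrow> f u = g u" "C1_on U f"
  shows "C1_on U g"
proof -
  obtain f' where f': "\<And>u. u \<in> U \<Longrightarrow> (f has_derivative blinfun_apply (f' u)) (at u)"
    "continuous_on U f'"
    using assms(3) unfolding C1_on_def by blast
  show ?thesis
    by (rule C1_onI[OF _ f'(2)])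
      (metis assms(1,2) f'(1) has_derivative_transform_within_open)
qed

lemma C1_on_mult:
  fixes f g :: "'e::real_normed_vector \<Rightarrow> real"
  assumes "C1_on U f" "C1_on U g"
  shows "C1_on U (\<lambda>u. f u * g u)"
proof -
  obtain f' where f': "\<And>u. u \<in> U \<Longrightarrow> (f has_derivative blinfun_apply (f' u)) (at u)"
    "continuous_on U f'"
    using assms(1) unfolding C1_on_def by blast
  obtain g' where g': "\<And>u. u \<in> U \<Longrightarrow> (g has_derivative blinfun_apply (g' u)) (at u)"
    "continuous_on U g'"
    using assms(2) unfolding C1_on_def by blast
  show ?thesis
  proof (rule C1_onI[where f' = "\<lambda>u. f u *\<^sub>R g' u + g u *\<^sub>R f' u"])
    fix u assume "u \<in> U"
    show "((\<lambda>u. f u * g u) has_derivative blinfun_apply (f u *\<^sub>R g' u + g u *\<^sub>R f' u)) (at u)"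
      by (rule has_derivative_eq_rhs, rule has_derivative_mult[OF f'(1) g'(1)])
        (use \<open>u \<in> U\<close> in \<open>auto simp: blinfun.bilinear_simps fun_eq_iff\<close>)
  next
    show "continuous_on U (\<lambda>u. f u *\<^sub>R g' u + g u *\<^sub>R f' u)"
      by (intro continuous_intros f' g' C1_on_imp_continuous_on assms)
  qed
qed

lemma C1_on_add:
  assumes "C1_on U f" "C1_on U g"
  shows "C1_on U (\<lambda>u. f u + g u)"
proof -
  obtain f' where f': "\<And>u. u \<in> U \<Longrightarrow> (f has_derivative blinfun_apply (f' u)) (at u)"
    "continuous_on U f'"
    using assms(1) unfolding C1_on_def by blast
  obtain g' where g': "\<And>u. u \<in> U \<Longrightarrow> (g has_derivative blinfun_apply (g' u)) (at u)"
    "continuous_on U g'"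
    using assms(2) unfolding C1_on_def by blast
  show ?thesis
  proof (rule C1_onI[where f' = "\<lambda>u. f' u + g' u"])
    fix u assume "u \<in> U"
    then show "((\<lambda>u. f u + g u) has_derivative blinfun_apply (f' u + g' u)) (at u)"
      unfolding plus_blinfun.rep_eq by (intro has_derivative_add f' g')
  qed (intro continuous_intros f' g')
qed

lemma C1_on_sum:
  assumes "\<And>i. i \<in> S \<Longrightarrow> C1_on U (f i)"
  shows "C1_on U (\<lambda>u. \<Sum>i\<in>S. f i u)"
  using assms by (induction S rule: infinite_finite_induct) (auto intro: C1_on_add C1_on_const)

lemma C1_on_prod:
  fixes f :: "'i \<Rightarrow> 'e::real_normed_vector \<Rightarrow> real"
  assumes "\<And>i. i \<in> S \<Longrightarrow> C1_on U (f i)"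
  shows "C1_on U (\<lambda>u. \<Prod>i\<in>S. f i u)"
  using assms by (induction S rule: infinite_finite_induct) (auto intro: C1_on_mult C1_on_const)

lemma C1_on_bounded_linear:
  assumes "bounded_linear h" "C1_on U f"
  shows "C1_on U (\<lambda>u. h (f u))"
proof -
  obtain f' where f': "\<And>u. u \<in> U \<Longrightarrow> (f has_derivative blinfun_apply (f' u)) (at u)"
    "continuous_on U f'"
    using assms(2) unfolding C1_on_def by blast
  show ?thesis
  proof (rule C1_onI[where f' = "\<lambda>u. Blinfun h o\<^sub>L f' u"])
    fix u assume "u \<in> U"
    then show "((\<lambda>u. h (f u)) has_derivative blinfun_apply (Blinfun h o\<^sub>L f' u)) (at u)"
      using bounded_linear.has_derivative[OF assms(1) f'(1)[OF \<open>u \<in> U\<close>]]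
      by (simp add: blinfun_compose.rep_eq o_def bounded_linear_Blinfun_apply[OF assms(1)])
  qed (intro continuous_intros f')
qed

text \<open>Freezing one of the two points turns the joint smoothness of \<open>H(y, x)\<close> into smoothness in
  the other point.\<close>

lemma C1_on_slice:
  assumes "C1_on (U \<times> V) f"
  shows "b \<in> V \<Longrightarrow> C1_on U (\<lambda>u. f (u, b))"
    and "a \<in> U \<Longrightarrow> C1_on V (\<lambda>v. f (a, v))"
proof -
  obtain f' where f': "\<And>w. w \<in> U \<times> V \<Longrightarrow> (f has_derivative blinfun_apply (f' w)) (at w)"
    "continuous_on (U \<times> V) f'"
    using assms unfolding C1_on_def by blast
  have bl1: "bounded_linear (\<lambda>u::'a. (u, 0::'b))" and bl2: "bounded_linear (\<lambda>v::'b. (0::'a, v))"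
    by (intro bounded_linear_Pair bounded_linear_ident bounded_linear_zero)+
  show "C1_on U (\<lambda>u. f (u, b))" if "b \<in> V"
  proof (rule C1_onI[where f' = "\<lambda>u. f' (u, b) o\<^sub>L Blinfun (\<lambda>u. (u, 0))"])
    fix u assume "u \<in> U"
    have "((\<lambda>u. (u, b)) has_derivative (\<lambda>u. (u, 0))) (at u)"
      by (auto intro!: derivative_eq_intros)
    from has_derivative_compose[OF this f'(1)] \<open>u \<in> U\<close> that
    show "((\<lambda>u. f (u, b)) has_derivative blinfun_apply (f' (u, b) o\<^sub>L Blinfun (\<lambda>u. (u, 0)))) (at u)"
      by (simp add: bounded_linear_Blinfun_apply[OF bl1] blinfun_compose.rep_eq o_def)
  qed (intro continuous_intros continuous_on_compose2[OF f'(2)], use that in auto)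
  show "C1_on V (\<lambda>v. f (a, v))" if "a \<in> U"
  proof (rule C1_onI[where f' = "\<lambda>v. f' (a, v) o\<^sub>L Blinfun (\<lambda>v. (0, v))"])
    fix v assume "v \<in> V"
    have "((\<lambda>v. (a, v)) has_derivative (\<lambda>v. (0, v))) (at v)"
      by (auto intro!: derivative_eq_intros)
    from has_derivative_compose[OF this f'(1)] \<open>v \<in> V\<close> that
    show "((\<lambda>v. f (a, v)) has_derivative blinfun_apply (f' (a, v) o\<^sub>L Blinfun (\<lambda>v. (0, v)))) (at v)"
      by (simp add: bounded_linear_Blinfun_apply[OF bl2] blinfun_compose.rep_eq o_def)
  qed (intro continuous_intros continuous_on_compose2[OF f'(2)], use that in auto)
qed

lemma C1_on_compose_path:
  assumes "C1_on U f" "C1_within J T \<phi>" "\<phi> ` T \<subseteq> U" "T \<subseteq> J"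
  shows "C1_within J T (\<lambda>t. f (\<phi> t))"
proof -
  obtain f' where f': "\<And>u. u \<in> U \<Longrightarrow> (f has_derivative blinfun_apply (f' u)) (at u)"
    "continuous_on U f'"
    using assms(1) unfolding C1_on_def by blast
  obtain \<phi>' where \<phi>': "\<And>t. t \<in> T \<Longrightarrow> (\<phi> has_vector_derivative \<phi>' t) (at t within J)"
    "continuous_on T \<phi>'"
    using assms(2) unfolding C1_within_def by blast
  have "continuous_on T \<phi>"
    using \<phi>'(1) assms(4)
    by (meson continuous_on_eq_continuous_within continuous_within_subset has_vector_derivative_continuous)
  then have "continuous_on T (\<lambda>t. f' (\<phi> t) (\<phi>' t))"
    using assms(3) by (intro continuous_intros \<phi>'(2) continuous_on_compose2[OF f'(2)]) auto
  moreover have "((\<lambda>t. f (\<phi> t)) has_vector_derivative f' (\<phi> t) (\<phi>' t)) (at t within J)"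
    if "t \<in> T" for t
    using vector_derivative_diff_chain_within[OF \<phi>'(1)[OF that], of f "f' (\<phi> t)"] f'(1)[of "\<phi> t"] that assms(3)
    by (auto simp: o_def has_derivative_at_withinI)
  ultimately show ?thesis
    unfolding C1_within_def by (intro exI[of _ "\<lambda>t. f' (\<phi> t) (\<phi>' t)"]) auto
qed

text \<open>The derivatives are relative to \<open>J\<close> rather than to \<open>T\<close>, so agreement of the functions on \<open>T\<close>
  determines them only because \<open>T\<close> is relatively open in \<open>J\<close>.\<close>

lemma C1_within_cong:
  assumes "C1_within J T f" "\<And>t. t \<in> T \<Longrightarrow> \<exists>\<epsilon>>0. \<forall>u\<in>J. dist u t < \<epsilon> \<longrightarrow> u \<in> T" "T \<subseteq> J"
    and "\<And>t. t \<in> T \<Longrightarrow> f t = g t"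
  shows "C1_within J T g"
proof -
  obtain f' where f': "\<And>t. t \<in> T \<Longrightarrow> (f has_vector_derivative f' t) (at t within J)"
    "continuous_on T f'"
    using assms(1) unfolding C1_within_def by blast
  have "(g has_vector_derivative f' t) (at t within J)" if t: "t \<in> T" for t
  proof -
    obtain \<epsilon> where "\<epsilon> > 0" "\<And>u. u \<in> J \<Longrightarrow> dist u t < \<epsilon> \<Longrightarrow> u \<in> T"
      using assms(2)[OF t] by blast
    with assms(3,4) t show ?thesis
      by (intro has_vector_derivative_transform_within[OF f'(1)[OF t]]) auto
  qed
  with f'(2) show ?thesis
    unfolding C1_within_def by blast
qed

section \<open>Sums over multi-indices\<close>

lemma sum_lists_Suc:
  fixes f :: "'n::finite list \<Rightarrow> 'b::comm_monoid_add"
  shows "(\<Sum>K | length K = Suc p. f K) = (\<Sum>k\<in>UNIV. \<Sum>K | length K = p. f (k # K))"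
proof -
  have "(\<Sum>K | length K = Suc p. f K) = (\<Sum>(k, K)\<in>UNIV \<times> {K. length K = p}. f (k # K))"
    by (rule sum.reindex_bij_witness[where i = "\<lambda>(k, K). k # K" and j = "\<lambda>K. (hd K, tl K)"])
      (auto simp: length_Suc_conv)
  then show ?thesis
    by (simp add: sum.cartesian_product)
qed

lemma finite_multi_indices: "finite {K :: 'n::finite list. length K = p}"
  using finite_lists_length_eq[of "UNIV :: 'n set" p] by simp

text \<open>Distributivity: the choices of \<open>k\<close> in the \<open>p\<close> factors on the right are the multi-indices \<open>K\<close>.\<close>

lemma sum_lists_prod:
  fixes f :: "nat \<Rightarrow> 'n::finite \<Rightarrow> real"
  shows "(\<Sum>K | length K = p. \<Prod>r<p. f r (K ! r)) = (\<Prod>r<p. \<Sum>k\<in>UNIV. f r k)"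
proof (induction p arbitrary: f)
  case (Suc p)
  have "(\<Sum>K | length K = Suc p. \<Prod>r<Suc p. f r (K ! r)) =
      (\<Sum>k\<in>UNIV. f 0 k * (\<Sum>K | length K = p. \<Prod>r<p. f (Suc r) (K ! r)))"
    unfolding sum_lists_Suc prod.lessThan_Suc_shift by (simp add: sum_distrib_left)
  also have "\<dots> = (\<Prod>r<Suc p. \<Sum>k\<in>UNIV. f r k)"
    using Suc.IH[of "\<lambda>r. f (Suc r)"] unfolding prod.lessThan_Suc_shift
    by (simp add: sum_distrib_right)
  finally show ?case .
qed simp

text \<open>The tensor powers of matrices compose like the matrices themselves: upper indices multiply in
  one order, lower indices, which transform contragrediently, in the other.\<close>

lemma sum_multi_index_products:
  fixes a a' b b' :: "'n::finite \<Rightarrow> 'n \<Rightarrow> real"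
  shows "(\<Sum>K' | length K' = p. \<Sum>M' | length M' = q.
      ((\<Prod>r<p. a (I ! r) (K' ! r)) * (\<Prod>s<q. b (M' ! s) (J ! s))) *
      ((\<Prod>r<p. a' (K' ! r) (K ! r)) * (\<Prod>s<q. b' (M ! s) (M' ! s)))) =
    (\<Prod>r<p. \<Sum>k\<in>UNIV. a (I ! r) k * a' k (K ! r)) *
    (\<Prod>s<q. \<Sum>m\<in>UNIV. b' (M ! s) m * b m (J ! s))"
    (is "?lhs = _")
proof -
  have "?lhs = (\<Sum>K' | length K' = p. \<Sum>M' | length M' = q.
      (\<Prod>r<p. a (I ! r) (K' ! r) * a' (K' ! r) (K ! r)) *
      (\<Prod>s<q. b' (M ! s) (M' ! s) * b (M' ! s) (J ! s)))"
    unfolding prod.distrib by (intro sum.cong refl) (simp add: mult_ac)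
  also have "\<dots> = (\<Sum>K' | length K' = p. \<Prod>r<p. a (I ! r) (K' ! r) * a' (K' ! r) (K ! r)) *
      (\<Sum>M' | length M' = q. \<Prod>s<q. b' (M ! s) (M' ! s) * b (M' ! s) (J ! s))"
    by (rule sum_product[symmetric])
  finally show ?thesis
    using sum_lists_prod[where f = "\<lambda>r k. a (I ! r) k * a' k (K ! r)"]
      sum_lists_prod[where f = "\<lambda>s m. b' (M ! s) m * b m (J ! s)"] by simp
qed

section \<open>Charts and coordinate tensors\<close>

locale C1_atlas =
  fixes A :: "('a::topological_space, 'n::finite) chart set"
  assumes C1_manifold: "C1_manifold A"
begin

lemma charts_atD:
  assumes "c \<in> charts_at A x"
  shows "c \<in> A" "x \<in> fst c"
  using assms by (auto simp: charts_at_def)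

lemma chart_at_exists: "\<exists>c. c \<in> charts_at A x"
  using C1_manifold unfolding C1_manifold_def charts_at_def by blast

lemma chart_homeomorphism:
  assumes "c \<in> A"
  shows "open (fst c)" "open (snd c ` fst c)"
    "homeomorphism (fst c) (snd c ` fst c) (snd c) (chart_inv c)"
  using assms C1_manifold unfolding C1_manifold_def by auto

lemma chart_inv_chart [simp]: "c \<in> A \<Longrightarrow> y \<in> fst c \<Longrightarrow> chart_inv c (snd c y) = y"
  using chart_homeomorphism(3) by (auto simp: homeomorphism_def)

lemma open_chart_image:
  assumes "c \<in> A" "open W" "W \<subseteq> fst c"
  shows "open (snd c ` W)"
proof -
  have "openin (top_of_set (fst c)) W"
    using assms(2,3) by (simp add: openin_open_eq chart_homeomorphism(1)[OF assms(1)])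
  from homeomorphism_imp_open_map[OF chart_homeomorphism(3)[OF assms(1)] this]
  show ?thesis
    using chart_homeomorphism(2)[OF assms(1)] openin_open_trans by blast
qed

lemma open_chart_overlap:
  assumes "c \<in> A" "d \<in> A"
  shows "open (snd c ` (fst c \<inter> fst d))"
  using assms by (intro open_chart_image) (auto intro: chart_homeomorphism)

lemma transition_has_derivative:
  assumes "c \<in> charts_at A x" "d \<in> charts_at A x"
  shows "((\<lambda>v. snd d (chart_inv c v)) has_derivative (\<lambda>h. jac c d x *v h)) (at (snd c x))"
proof -
  have "C1_on (snd c ` (fst c \<inter> fst d)) (snd d \<circ> chart_inv c)"
    using C1_manifold charts_atD(1) assms unfolding C1_manifold_def by blast
  then have "(snd d \<circ> chart_inv c) differentiable (at (snd c x))"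
    unfolding C1_on_def differentiable_def using assms by (auto dest: charts_atD)
  then show ?thesis
    unfolding jacobian_works jac_def by (simp add: o_def)
qed

text \<open>The chain rule, applied to the coordinate change from \<open>c\<close> to \<open>e\<close> written via \<open>d\<close>, which is
  possible near \<open>x\<close>.\<close>

lemma jac_chain:
  assumes "c \<in> charts_at A x" "d \<in> charts_at A x" "e \<in> charts_at A x"
  shows "jac d e x ** jac c d x = jac c e x"
proof -
  note A = charts_atD[OF assms(1)] charts_atD[OF assms(2)]
  have "((\<lambda>v. snd e (chart_inv d (snd d (chart_inv c v)))) has_derivative
      (\<lambda>h. jac d e x *v (jac c d x *v h))) (at (snd c x))"
    using transition_has_derivative[OF assms(2,3)] A
    by (intro has_derivative_compose[OF transition_has_derivative[OF assms(1,2)],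
      where g = "\<lambda>v. snd e (chart_inv d v)"]) simp
  then have "((\<lambda>v. snd e (chart_inv c v)) has_derivative
      (\<lambda>h. jac d e x *v (jac c d x *v h))) (at (snd c x))"
    by (rule has_derivative_transform_within_open[OF _ open_chart_overlap[OF A(1,3)]])
      (use A in auto)
  from has_derivative_unique[OF this transition_has_derivative[OF assms(1,3)]]
  show ?thesis
    by (auto simp: matrix_eq matrix_vector_mul_assoc fun_eq_iff)
qed

lemma jac_self:
  assumes "c \<in> charts_at A x"
  shows "jac c c x = mat 1"
proof -
  note A = charts_atD[OF assms]
  have "((\<lambda>v. v) has_derivative (\<lambda>h. jac c c x *v h)) (at (snd c x))"
    by (rule has_derivative_transform_within_open[OF transition_has_derivative[OF assms assms]
      open_chart_overlap[OF A(1,1)]]) (use A in auto)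
  from has_derivative_unique[OF has_derivative_ident this] show ?thesis
    by (simp add: matrix_eq fun_eq_iff)
qed

lemma transition_coeff_chain:
  assumes "c \<in> charts_at A x" "d \<in> charts_at A x" "e \<in> charts_at A x"
    and "length I = p" "length J = q"
  shows "(\<Sum>K' | length K' = p. \<Sum>M' | length M' = q.
      transition_coeff d e x K' M' I J * transition_coeff c d x K M K' M') =
    transition_coeff c e x K M I J" (is "?lhs = _")
proof -
  have "?lhs = (\<Sum>K' | length K' = p. \<Sum>M' | length M' = q.
      ((\<Prod>r<p. jac d e x $ (I ! r) $ (K' ! r)) * (\<Prod>s<q. jac e d x $ (M' ! s) $ (J ! s))) *
      ((\<Prod>r<p. jac c d x $ (K' ! r) $ (K ! r)) * (\<Prod>s<q. jac d c x $ (M ! s) $ (M' ! s))))"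
    unfolding transition_coeff_def using assms(4,5) by (intro sum.cong refl) auto
  also have "\<dots> = (\<Prod>r<p. \<Sum>k\<in>UNIV. jac d e x $ (I ! r) $ k * jac c d x $ k $ (K ! r)) *
      (\<Prod>s<q. \<Sum>m\<in>UNIV. jac d c x $ (M ! s) $ m * jac e d x $ m $ (J ! s))"
    by (rule sum_multi_index_products)
  also have "\<dots> = transition_coeff c e x K M I J"
    unfolding transition_coeff_def assms(4,5) jac_chain[OF assms(1-3), symmetric]
      jac_chain[OF assms(3,2,1), symmetric] by (simp add: matrix_matrix_mult_def)
  finally show ?thesis .
qed

text \<open>The transformation law, read as a rewrite rule, applies to its own right-hand side. Therefore
  the two parts of the definition are made available as separate rules.\<close>

lemma tensors_atI:
  assumes "\<And>c I J. c \<notin> charts_at A x \<or> length I \<noteq> p \<or> length J \<noteq> q \<Longrightarrow> S c I J = 0"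
    and "\<And>c d I J. c \<in> charts_at A x \<Longrightarrow> d \<in> charts_at A x \<Longrightarrow> length I = p \<Longrightarrow> length J = q \<Longrightarrow>
      S d I J = (\<Sum>K | length K = p. \<Sum>M | length M = q. transition_coeff c d x K M I J * S c K M)"
  shows "S \<in> tensors_at A x p q"
  unfolding tensors_at_def by (intro CollectI conjI ballI allI impI assms)

lemma coord_tensor_zero:
  assumes "d \<notin> charts_at A x \<or> length I \<noteq> length K \<or> length J \<noteq> length M"
  shows "coord_tensor A c K M x d I J = 0"
  using assms by (auto simp: coord_tensor_def)

lemma coord_tensor_in_tensors_at:
  assumes "c \<in> A"
  shows "coord_tensor A c K M x \<in> tensors_at A x (length K) (length M)"
proof (cases "x \<in> fst c")
  case True
  with assms have c: "c \<in> charts_at A x"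
    by (simp add: charts_at_def)
  have "coord_tensor A c K M x e I J =
      (\<Sum>K' | length K' = length K. \<Sum>M' | length M' = length M.
        transition_coeff d e x K' M' I J * coord_tensor A c K M x d K' M')"
    if "d \<in> charts_at A x" "e \<in> charts_at A x" "length I = length K" "length J = length M"
    for d e I J
  proof -
    have "(\<Sum>K' | length K' = length K. \<Sum>M' | length M' = length M.
        transition_coeff d e x K' M' I J * coord_tensor A c K M x d K' M') =
      (\<Sum>K' | length K' = length K. \<Sum>M' | length M' = length M.
        transition_coeff d e x K' M' I J * transition_coeff c d x K M K' M')"
      using that True by (intro sum.cong refl) (auto simp: coord_tensor_def)
    also have "\<dots> = transition_coeff c e x K M I J"
      using that by (intro transition_coeff_chain c)
    finally show ?thesis
      using that True by (simp add: coord_tensor_def)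
  qed
  from tensors_atI[OF coord_tensor_zero this] show ?thesis .
next
  case False
  then show ?thesis
    by (intro tensors_atI) (auto simp: coord_tensor_def)
qed

lemma tensors_at_zero:
  assumes "S \<in> tensors_at A x p q" "c \<notin> charts_at A x \<or> length I \<noteq> p \<or> length J \<noteq> q"
  shows "S c I J = 0"
proof -
  have "\<forall>c I J. c \<notin> charts_at A x \<or> length I \<noteq> p \<or> length J \<noteq> q \<longrightarrow> S c I J = 0"
    using assms(1) unfolding tensors_at_def mem_Collect_eq by (rule conjunct1)
  with assms(2) show ?thesis by blast
qed

lemma tensors_at_law:
  assumes "S \<in> tensors_at A x p q" "c \<in> charts_at A x" "d \<in> charts_at A x" "length I = p" "length J = q"
  shows "S d I J = (\<Sum>K | length K = p. \<Sum>M | length M = q. transition_coeff c d x K M I J * S c K M)"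
proof -
  have "\<forall>c\<in>charts_at A x. \<forall>d\<in>charts_at A x. \<forall>I J. length I = p \<longrightarrow> length J = q \<longrightarrow>
      S d I J = (\<Sum>K | length K = p. \<Sum>M | length M = q. transition_coeff c d x K M I J * S c K M)"
    using assms(1) unfolding tensors_at_def mem_Collect_eq by (rule conjunct2)
  from this[rule_format, OF assms(2-5)] show ?thesis .
qed

lemma tensors_at_lincomb:
  assumes "S \<in> tensors_at A x p q" "T \<in> tensors_at A x p q"
  shows "tensor_lincomb a S b T \<in> tensors_at A x p q"
proof -
  have "a * S d I J + b * T d I J =
     (\<Sum>K | length K = p. \<Sum>M | length M = q. transition_coeff c d x K M I J * (a * S c K M + b * T c K M))"
    if "c \<in> charts_at A x" "d \<in> charts_at A x" "length I = p" "length J = q" for c d I J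
    unfolding tensors_at_law[OF assms(1) that] tensors_at_law[OF assms(2) that]
    by (simp add: sum_distrib_left sum.distrib algebra_simps)
  moreover have "a * S c I J + b * T c I J = 0"
    if "c \<notin> charts_at A x \<or> length I \<noteq> p \<or> length J \<noteq> q" for c I J
    using tensors_at_zero[OF assms(1) that] tensors_at_zero[OF assms(2) that] by simp
  ultimately show ?thesis
    unfolding tensor_lincomb_def by (intro tensors_atI)
qed

end

section \<open>Flat linear transports in coordinates\<close>

locale flat_transport = C1_atlas A
  for A :: "('a::topological_space, 'n::finite) chart set" +
  fixes L :: "'a \<Rightarrow> 'a \<Rightarrow> ('a, 'n) tensor \<Rightarrow> ('a, 'n) tensor"
  assumes flat_linear_transport: "flat_linear_transport A L"
begin

lemma transport_in: "S \<in> tensors_at A x p q \<Longrightarrow> L x y S \<in> tensors_at A y p q"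
  and transport_lincomb: "S \<in> tensors_at A x p q \<Longrightarrow> T \<in> tensors_at A x p q \<Longrightarrow>
    L x y (tensor_lincomb a S b T) = tensor_lincomb a (L x y S) b (L x y T)"
  and transport_prod: "S \<in> tensors_at A x p q \<Longrightarrow> T \<in> tensors_at A x p' q' \<Longrightarrow>
    L x y (tensor_prod p q S T) = tensor_prod p q (L x y S) (L x y T)"
  and transport_contraction: "r \<le> p \<Longrightarrow> s \<le> q \<Longrightarrow> S \<in> tensors_at A x (Suc p) (Suc q) \<Longrightarrow>
    L x y (contraction r s S) = contraction r s (L x y S)"
  and transport_flat: "S \<in> tensors_at A x p q \<Longrightarrow> L y z (L x y S) = L x z S"
  and transport_refl: "S \<in> tensors_at A x p q \<Longrightarrow> L x x S = S"
proof -
  note L = flat_linear_transport[unfolded flat_linear_transport_def]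
  show "S \<in> tensors_at A x p q \<Longrightarrow> L x y S \<in> tensors_at A y p q"
    by (rule L[THEN conjunct1, rule_format])
  show "S \<in> tensors_at A x p q \<Longrightarrow> T \<in> tensors_at A x p q \<Longrightarrow>
    L x y (tensor_lincomb a S b T) = tensor_lincomb a (L x y S) b (L x y T)"
    by (rule L[THEN conjunct2, THEN conjunct1, rule_format])
  show "S \<in> tensors_at A x p q \<Longrightarrow> T \<in> tensors_at A x p' q' \<Longrightarrow>
    L x y (tensor_prod p q S T) = tensor_prod p q (L x y S) (L x y T)"
    by (rule L[THEN conjunct2, THEN conjunct2, THEN conjunct1, rule_format])
  show "r \<le> p \<Longrightarrow> s \<le> q \<Longrightarrow> S \<in> tensors_at A x (Suc p) (Suc q) \<Longrightarrow>
    L x y (contraction r s S) = contraction r s (L x y S)"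
    by (rule L[THEN conjunct2, THEN conjunct2, THEN conjunct2, THEN conjunct1, rule_format])
  show "S \<in> tensors_at A x p q \<Longrightarrow> L y z (L x y S) = L x z S"
    by (rule L[THEN conjunct2, THEN conjunct2, THEN conjunct2, THEN conjunct2, THEN conjunct1, rule_format])
  show "S \<in> tensors_at A x p q \<Longrightarrow> L x x S = S"
    by (rule L[THEN conjunct2, THEN conjunct2, THEN conjunct2, THEN conjunct2, THEN conjunct2, rule_format])
qed

lemma zero_in_tensors_at: "(\<lambda>d I J. 0) \<in> tensors_at A x p q"
  by (intro tensors_atI) auto

lemma transport_zero: "L x y (\<lambda>d I J. 0) = (\<lambda>d I J. 0)"
proof -
  have *: "tensor_lincomb 0 S 0 T = (\<lambda>d I J. 0)" for S T :: "('a, 'n) tensor"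
    by (simp add: tensor_lincomb_def)
  show ?thesis
    using transport_lincomb[OF zero_in_tensors_at zero_in_tensors_at, of x y 0 0] by (simp only: *)
qed

lemma transport_sum:
  assumes "finite F" "\<And>i. i \<in> F \<Longrightarrow> T i \<in> tensors_at A x p q"
  shows "(\<lambda>d I J. \<Sum>i\<in>F. a i * T i d I J) \<in> tensors_at A x p q \<and>
    L x y (\<lambda>d I J. \<Sum>i\<in>F. a i * T i d I J) = (\<lambda>d I J. \<Sum>i\<in>F. a i * L x y (T i) d I J)"
  using assms
proof (induction F)
  case empty
  then show ?case
    by (simp add: transport_zero zero_in_tensors_at)
next
  case (insert i F)
  let ?S = "\<lambda>d I J. \<Sum>i\<in>F. a i * T i d I J"
  have S: "?S \<in> tensors_at A x p q"
    "L x y ?S = (\<lambda>d I J. \<Sum>i\<in>F. a i * L x y (T i) d I J)"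
    and T: "T i \<in> tensors_at A x p q"
    using insert by auto
  have "(\<lambda>d I J. \<Sum>i\<in>insert i F. a i * T i d I J) = tensor_lincomb (a i) (T i) 1 ?S"
    using insert.hyps by (simp add: tensor_lincomb_def)
  then show ?case
    using insert.hyps tensors_at_lincomb[OF T S(1), of "a i" 1]
      transport_lincomb[OF T S(1), of y "a i" 1] S(2)
    by (simp add: tensor_lincomb_def)
qed

lemma transport_expansion:
  assumes "S \<in> tensors_at A x p q" "c \<in> charts_at A x"
  shows "L x y S d I J =
    (\<Sum>K | length K = p. \<Sum>M | length M = q. S c K M * L x y (coord_tensor A c K M x) d I J)"
proof -
  let ?F = "{K::'n list. length K = p} \<times> {M::'n list. length M = q}"
  have "coord_tensor A c K M x \<in> tensors_at A x p q" if "(K, M) \<in> ?F" for K M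
    using coord_tensor_in_tensors_at[OF charts_atD(1)[OF assms(2)], of K M x] that by simp
  moreover have "finite ?F"
    by (intro finite_cartesian_product finite_multi_indices)
  ultimately have "L x y (\<lambda>d I J. \<Sum>(K, M)\<in>?F. S c K M * coord_tensor A c K M x d I J) =
      (\<lambda>d I J. \<Sum>(K, M)\<in>?F. S c K M * L x y (coord_tensor A c K M x) d I J)"
    using transport_sum[where F = ?F and T = "\<lambda>(K, M). coord_tensor A c K M x" and x = x and y = y
      and p = p and q = q and a = "\<lambda>(K, M). S c K M"]
    by (auto simp: case_prod_unfold)
  then have "L x y S = (\<lambda>d I J. \<Sum>(K, M)\<in>?F. S c K M * L x y (coord_tensor A c K M x) d I J)"
    by (subst tensor_expansion[OF assms]) (simp add: sum.cartesian_product)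
  then show ?thesis
    by (simp add: sum.cartesian_product)
qed

text \<open>The scalar \<open>1\<close> is idempotent under the tensor product, hence so is its transport, which must
  then be \<open>0\<close> or \<open>1\<close>; the value \<open>0\<close> is excluded because transport is invertible. This starts the
  induction in \<open>transport_coord_tensor\<close>.\<close>

lemma transport_scalar_one:
  assumes "c \<in> charts_at A x" "d \<in> charts_at A y"
  shows "L x y (coord_tensor A c [] [] x) = coord_tensor A d [] [] y"
proof -
  let ?u = "coord_tensor A c [] [] x" and ?v = "coord_tensor A d [] [] y"
  let ?a = "L x y ?u d [] []"
  have u: "?u \<in> tensors_at A x 0 0"
    using coord_tensor_in_tensors_at[OF charts_atD(1)[OF assms(1)], of "[]" "[]" x] by simp
  have "tensor_prod 0 0 ?u ?u = ?u"
    by (auto simp: tensor_prod_def coord_tensor_def transition_coeff_def fun_eq_iff)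
  with transport_prod[OF u u, of y] have "tensor_prod 0 0 (L x y ?u) (L x y ?u) = L x y ?u"
    by simp
  then have "tensor_prod 0 0 (L x y ?u) (L x y ?u) d [] [] = ?a"
    by (rule arg_cong)
  then have "?a * ?a = ?a"
    by (simp add: tensor_prod_def)
  moreover have expand: "L x y ?u = (\<lambda>e I J. ?a * ?v e I J)"
    using tensor_expansion[OF transport_in[OF u] assms(2)] by simp
  have "?a \<noteq> 0"
  proof
    assume "?a = 0"
    with expand have "L x y ?u = (\<lambda>d I J. 0)"
      by simp
    with transport_flat[OF u, where y = y and z = x] transport_refl[OF u] have "?u = (\<lambda>d I J. 0)"
      by (simp add: transport_zero)
    then have "?u c [] [] = 0"
      by (simp only:)
    then show False
      using assms(1) by (simp add: coord_tensor_def transition_coeff_def charts_at_def)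
  qed
  ultimately have "?a = 1"
    by simp
  with expand show ?thesis
    by simp
qed

abbreviation H where "H \<equiv> transport_matrix A L"

lemma transport_coord_vector: "L x y (coord_vector A c k x) d [i] [] = H d c y x $ i $ k"
  by (simp add: transport_matrix_def)

lemma coord_vector_in_tensors_at:
  assumes "c \<in> A"
  shows "coord_vector A c k x \<in> tensors_at A x 1 0"
  using coord_tensor_in_tensors_at[OF assms, of "[k]" "[]" x] by simp

text \<open>Flatness in coordinates. With \<open>transport_matrix_refl\<close> it says that \<open>H(x, y)\<close> is the inverse
  matrix of \<open>H(y, x)\<close>.\<close>

lemma transport_matrix_flat:
  assumes "c \<in> charts_at A x" "d \<in> charts_at A y" "e \<in> charts_at A z"
  shows "H e d z y ** H d c y x = H e c z x"
proof -
  have "H e c z x $ i $ k = (\<Sum>j\<in>UNIV. H e d z y $ i $ j * H d c y x $ j $ k)" for i k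
  proof -
    note E = coord_vector_in_tensors_at[OF charts_atD(1)[OF assms(1)], of k x]
    have "H e c z x $ i $ k = L y z (L x y (coord_vector A c k x)) e [i] []"
      by (simp add: transport_flat[OF E] transport_coord_vector)
    also have "\<dots> = (\<Sum>j\<in>UNIV. H d c y x $ j $ k * H e d z y $ i $ j)"
      unfolding transport_expansion[OF transport_in[OF E] assms(2)]
      by (simp add: sum_lists_Suc transport_coord_vector)
    finally show ?thesis
      by (simp add: mult.commute)
  qed
  then show ?thesis
    by (simp add: vec_eq_iff matrix_matrix_mult_def)
qed

lemma transport_matrix_refl:
  assumes "c \<in> charts_at A x"
  shows "H c c x x = mat 1"
proof -
  have "H c c x x $ i $ k = jac c c x $ i $ k" for i k
    unfolding transport_coord_vector[symmetric]
      transport_refl[OF coord_vector_in_tensors_at[OF charts_atD(1)[OF assms]]]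
    using assms charts_atD[OF assms] by (simp add: coord_tensor_def transition_coeff_def)
  then show ?thesis
    by (simp add: vec_eq_iff jac_self[OF assms])
qed

text \<open>The contraction of \<open>\<partial>\<^sub>k\<close> with \<open>dx\<^sup>m\<close> is the scalar \<open>\<delta>\<^sup>m\<^sub>k\<close>, and transport preserves both
  contractions and scalars. Hence the matrix \<open>G\<close> that transports covectors satisfies
  \<open>G H(y, x) = 1\<close>, which determines it as \<open>H(x, y)\<close>.\<close>

lemma transport_coord_covector:
  assumes "c \<in> charts_at A x" "d \<in> charts_at A y"
  shows "L x y (coord_tensor A c [] [m] x) d [] [j] = H c d x y $ m $ j"
proof -
  note A = charts_atD[OF assms(1)]
  define G :: "real ^ 'n ^ 'n" where "G = (\<chi> m j. L x y (coord_tensor A c [] [m] x) d [] [j])"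
  have "(\<Sum>i\<in>UNIV. H d c y x $ i $ k * G $ m $ i) = mat 1 $ m $ k" for m k
  proof -
    let ?E = "coord_vector A c k x" and ?\<theta> = "coord_tensor A c [] [m] x"
    let ?u = "coord_tensor A c [] [] x"
    have E: "?E \<in> tensors_at A x 1 0" and \<theta>: "?\<theta> \<in> tensors_at A x 0 1"
      and u: "?u \<in> tensors_at A x 0 0"
      using coord_tensor_in_tensors_at[OF A(1), of "[k]" "[]" x]
        coord_tensor_in_tensors_at[OF A(1), of "[]" "[m]" x]
        coord_tensor_in_tensors_at[OF A(1), of "[]" "[]" x] by simp_all
    have prod_eq: "tensor_prod 1 0 ?E ?\<theta> = coord_tensor A c [k] [m] x"
      by (auto simp: tensor_prod_def coord_tensor_def transition_coeff_def fun_eq_iff length_Suc_conv)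
    have T: "coord_tensor A c [k] [m] x \<in> tensors_at A x (Suc 0) (Suc 0)"
      using coord_tensor_in_tensors_at[OF A(1), of "[k]" "[m]" x] by simp
    \<comment> \<open>The second summand only gives the multiple of \<open>?u\<close> the form required by linearity.\<close>
    have contr: "contraction 0 0 (coord_tensor A c [k] [m] x) =
        tensor_lincomb (mat 1 $ m $ k) ?u 0 ?u"
    proof (intro ext)
      fix e I J
      show "contraction 0 0 (coord_tensor A c [k] [m] x) e I J =
          tensor_lincomb (mat 1 $ m $ k) ?u 0 ?u e I J"
      proof (cases "e \<in> charts_at A x \<and> I = [] \<and> J = []")
        case True
        then have "contraction 0 0 (coord_tensor A c [k] [m] x) e I J =
            (\<Sum>i\<in>UNIV. jac e c x $ m $ i * jac c e x $ i $ k)"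
          using A by (simp add: contraction_def coord_tensor_def transition_coeff_def mult.commute)
        also have "\<dots> = (jac e c x ** jac c e x) $ m $ k"
          by (simp add: matrix_matrix_mult_def)
        also have "\<dots> = mat 1 $ m $ k"
          using True assms(1) by (simp add: jac_chain jac_self)
        finally show ?thesis
          using True A by (simp add: tensor_lincomb_def coord_tensor_def transition_coeff_def)
      qed (auto simp: contraction_def coord_tensor_def tensor_lincomb_def)
    qed
    have "(\<Sum>i\<in>UNIV. H d c y x $ i $ k * G $ m $ i) =
        contraction 0 0 (tensor_prod 1 0 (L x y ?E) (L x y ?\<theta>)) d [] []"
      by (simp add: contraction_def tensor_prod_def G_def transport_coord_vector)
    also have "tensor_prod 1 0 (L x y ?E) (L x y ?\<theta>) = L x y (coord_tensor A c [k] [m] x)"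
      by (simp only: transport_prod[OF E \<theta>, symmetric] prod_eq)
    also have "contraction 0 0 \<dots> = L x y (contraction 0 0 (coord_tensor A c [k] [m] x))"
      using transport_contraction[OF _ _ T] by simp
    also have "\<dots> = tensor_lincomb (mat 1 $ m $ k) (L x y ?u) 0 (L x y ?u)"
      unfolding contr by (rule transport_lincomb[OF u u])
    also have "\<dots> d [] [] = mat 1 $ m $ k"
      unfolding transport_scalar_one[OF assms] using assms(2) charts_atD[OF assms(2)]
      by (simp add: tensor_lincomb_def coord_tensor_def transition_coeff_def)
    finally show ?thesis .
  qed
  then have "G ** H d c y x = mat 1"
    by (simp add: vec_eq_iff matrix_matrix_mult_def mult.commute)
  then have "G ** (H d c y x ** H c d x y) = H c d x y"
    by (simp add: matrix_mul_assoc)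
  then have "G = H c d x y"
    by (simp add: transport_matrix_flat[OF assms(2,1,2)] transport_matrix_refl[OF assms(2)])
  then show ?thesis
    by (simp add: G_def vec_eq_iff)
qed

lemma coord_tensor_Cons_upper:
  "coord_tensor A c (k # K) M x = tensor_prod 1 0 (coord_vector A c k x) (coord_tensor A c K M x)"
proof (intro ext)
  fix d I J
  show "coord_tensor A c (k # K) M x d I J =
      tensor_prod 1 0 (coord_vector A c k x) (coord_tensor A c K M x) d I J"
    by (cases I) (auto simp: tensor_prod_def coord_tensor_def transition_coeff_def
        prod.lessThan_Suc_shift simp del: prod.lessThan_Suc)
qed

lemma coord_tensor_Cons_lower:
  "coord_tensor A c [] (m # M) x = tensor_prod 0 1 (coord_tensor A c [] [m] x) (coord_tensor A c [] M x)"
proof (intro ext)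
  fix d I J
  show "coord_tensor A c [] (m # M) x d I J =
      tensor_prod 0 1 (coord_tensor A c [] [m] x) (coord_tensor A c [] M x) d I J"
    by (cases J) (auto simp: tensor_prod_def coord_tensor_def transition_coeff_def
        prod.lessThan_Suc_shift simp del: prod.lessThan_Suc)
qed

text \<open>A coordinate tensor is a product of coordinate vectors and covectors, so it is transported
  factor by factor. As the right-hand side only involves \<open>H\<close>, this carries the smoothness of \<open>H\<close>
  over to all tensor types.\<close>

lemma transport_coord_tensor:
  assumes "c \<in> charts_at A x" "d \<in> charts_at A y" "length I = length K" "length J = length M"
  shows "L x y (coord_tensor A c K M x) d I J =
    (\<Prod>r<length I. H d c y x $ (I ! r) $ (K ! r)) * (\<Prod>s<length J. H c d x y $ (M ! s) $ (J ! s))"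
  using assms(3)
proof (induction K arbitrary: I)
  case Nil
  from assms(4) have "L x y (coord_tensor A c [] M x) d [] J = (\<Prod>s<length J. H c d x y $ (M ! s) $ (J ! s))"
  proof (induction M arbitrary: J)
    case Nil
    then show ?case
      using transport_scalar_one[OF assms(1,2)] assms(2) charts_atD[OF assms(2)]
      by (simp add: coord_tensor_def transition_coeff_def)
  next
    case (Cons m M)
    then obtain j J' where J: "J = j # J'" "length J' = length M"
      by (cases J) auto
    have "coord_tensor A c [] [m] x \<in> tensors_at A x 0 1"
      "coord_tensor A c [] M x \<in> tensors_at A x 0 (length M)"
      using coord_tensor_in_tensors_at[OF charts_atD(1)[OF assms(1)], of "[]" "[m]" x]
        coord_tensor_in_tensors_at[OF charts_atD(1)[OF assms(1)], of "[]" M x] by simp_all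
    from transport_prod[OF this, of y] show ?case
      by (simp add: coord_tensor_Cons_lower[of c m M] tensor_prod_def J Cons.IH[OF J(2)]
          transport_coord_covector[OF assms(1,2)] prod.lessThan_Suc_shift del: prod.lessThan_Suc)
  qed
  with Nil show ?case
    by simp
next
  case (Cons k K)
  then obtain i I' where I: "I = i # I'" "length I' = length K"
    by (cases I) auto
  have "coord_vector A c k x \<in> tensors_at A x 1 0"
    "coord_tensor A c K M x \<in> tensors_at A x (length K) (length M)"
    using charts_atD(1)[OF assms(1)]
    by (auto intro: coord_tensor_in_tensors_at coord_vector_in_tensors_at simp del: One_nat_def)
  from transport_prod[OF this, of y] show ?case
    by (simp add: coord_tensor_Cons_upper[of c k K] tensor_prod_def I Cons.IH[OF I(2)]
        transport_coord_vector prod.lessThan_Suc_shift del: prod.lessThan_Suc)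
qed

end

section \<open>The covariant derivative as the derivative of a pull-back\<close>

locale C1_flat_transport = flat_transport A L
  for A :: "('a::topological_space, 'n::finite) chart set" and L +
  assumes C1_transport: "C1_transport A L"
begin

lemma transport_matrix_C1:
  assumes "c \<in> A" "d \<in> charts_at A x"
  shows "C1_on (snd c ` fst c) (\<lambda>v. H c d (chart_inv c v) x $ i $ j)"
    and "C1_on (snd c ` fst c) (\<lambda>v. H d c x (chart_inv c v) $ i $ j)"
proof -
  note D = charts_atD[OF assms(2)]
  have bl: "bounded_linear (\<lambda>X :: real ^ 'n ^ 'n. X $ i $ j)"
    by (intro bounded_linear_compose[OF bounded_linear_vec_nth bounded_linear_vec_nth])
  have u: "snd d x \<in> snd d ` fst d"
    using D by blast
  have "C1_on (snd c ` fst c \<times> snd d ` fst d) (\<lambda>(v, u). H c d (chart_inv c v) (chart_inv d u))"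
    "C1_on (snd d ` fst d \<times> snd c ` fst c) (\<lambda>(v, u). H d c (chart_inv d v) (chart_inv c u))"
    using C1_transport D(1) assms(1) unfolding C1_transport_def by blast+
  from C1_on_slice(1)[OF this(1) u] C1_on_slice(2)[OF this(2) u]
  show "C1_on (snd c ` fst c) (\<lambda>v. H c d (chart_inv c v) x $ i $ j)"
    "C1_on (snd c ` fst c) (\<lambda>v. H d c x (chart_inv c v) $ i $ j)"
    using D by (auto intro: C1_on_bounded_linear[OF bl])
qed

lemma chart_inv_in_chart:
  assumes "c \<in> A" "v \<in> snd c ` fst c"
  shows "c \<in> charts_at A (chart_inv c v)" "snd c (chart_inv c v) = v"
  using assms by (auto simp: charts_at_def)

text \<open>The functions whose derivatives are the Christoffel symbols of \<open>\<nabla>\<^sup>L\<close>: by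
  \<open>generated_connection_coord\<close>, their partial derivatives at \<open>x\<close> are the components of
  \<open>\<nabla>\<^sub>k E\<^sub>K\<^sup>M\<close>.\<close>

lemma pulled_back_frame_C1:
  assumes "c \<in> A"
  shows "C1_on (snd c ` fst c)
    (\<lambda>v. L (chart_inv c v) x (coord_tensor A c K M (chart_inv c v)) d I J)"
proof (cases "d \<in> charts_at A x \<and> length I = length K \<and> length J = length M")
  case True
  show ?thesis
  proof (rule C1_on_cong[OF chart_homeomorphism(2)[OF assms]])
    show "C1_on (snd c ` fst c)
        (\<lambda>v. (\<Prod>r<length I. H d c x (chart_inv c v) $ (I ! r) $ (K ! r)) *
          (\<Prod>s<length J. H c d (chart_inv c v) x $ (M ! s) $ (J ! s)))"
      using True by (intro C1_on_mult C1_on_prod transport_matrix_C1 assms) auto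
  qed (use True in \<open>simp add: transport_coord_tensor chart_inv_in_chart[OF assms]\<close>)
next
  case False
  then have "L y x (coord_tensor A c K M y) d I J = 0" for y
    using tensors_at_zero[OF transport_in[OF coord_tensor_in_tensors_at[OF assms]]] by blast
  then show ?thesis
    by (simp add: C1_on_const)
qed

lemma transported_tensor_C1:
  assumes "S \<in> tensors_at A x p q" "c \<in> A" "length I = p" "length J = q"
  shows "C1_on (snd c ` fst c) (\<lambda>v. L x (chart_inv c v) S c I J)"
proof -
  obtain d where d: "d \<in> charts_at A x"
    using chart_at_exists by blast
  show ?thesis
  proof (rule C1_on_cong[OF chart_homeomorphism(2)[OF assms(2)]])
    show "C1_on (snd c ` fst c)
        (\<lambda>v. \<Sum>K | length K = p. \<Sum>M | length M = q. S d K M *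
          ((\<Prod>r<length I. H c d (chart_inv c v) x $ (I ! r) $ (K ! r)) *
          (\<Prod>s<length J. H d c x (chart_inv c v) $ (M ! s) $ (J ! s))))"
      by (intro C1_on_mult C1_on_prod C1_on_sum C1_on_const transport_matrix_C1 assms(2) d)
  next
    fix v assume "v \<in> snd c ` fst c"
    then show "(\<Sum>K | length K = p. \<Sum>M | length M = q. S d K M *
          ((\<Prod>r<length I. H c d (chart_inv c v) x $ (I ! r) $ (K ! r)) *
          (\<Prod>s<length J. H d c x (chart_inv c v) $ (M ! s) $ (J ! s)))) = L x (chart_inv c v) S c I J"
      unfolding transport_expansion[OF assms(1) d]
      using assms(3,4)
      by (intro sum.cong refl) (simp add: transport_coord_tensor[OF d] chart_inv_in_chart[OF assms(2)])
  qed
qed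

text \<open>The connection is defined through a chart \<open>c'\<close> chosen arbitrarily around \<open>x\<close>. The curve
  \<open>x\<^sub>\<epsilon>\<close> that is a straight line in \<open>c'\<close> is in general curved in \<open>c\<close>, but its velocity at \<open>x\<close> is
  still \<open>\<partial>\<^sub>k\<close>, and by differentiability only the velocity matters.\<close>

lemma generated_connection_coord:
  assumes c: "c \<in> charts_at A x"
    and D: "((\<lambda>v. L (chart_inv c v) x (coord_tensor A c K M (chart_inv c v)) d I J)
      has_derivative D) (at (snd c x))"
  shows "generated_connection A L (coord_vector A c k) (coord_tensor A c K M) x d I J = D (axis k 1)"
proof -
  define c' where "c' = (SOME c. c \<in> charts_at A x)"
  have c': "c' \<in> charts_at A x"
    unfolding c'_def using chart_at_exists by (rule someI_ex)
  note A = charts_atD[OF c] charts_atD[OF c']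
  define w where "w = (\<chi> i. coord_vector A c k x c' [i] [])"
  have w: "w = jac c c' x *v axis k 1"
    unfolding w_def using A c'
    by (simp add: vec_eq_iff matrix_vector_mul_component coord_tensor_def transition_coeff_def
        inner_axis)
  define y where "y = (\<lambda>\<epsilon>::real. chart_inv c' (snd c' x + \<epsilon> *\<^sub>R w))"
  define g where "g = (\<lambda>y. L y x (coord_tensor A c K M y) d I J)"
  let ?W = "(\<lambda>\<epsilon>::real. snd c' x + \<epsilon> *\<^sub>R w) -` (snd c' ` (fst c' \<inter> fst c))"
  have "open ?W"
    by (intro open_vimage open_chart_overlap A continuous_intros)
  have y0: "y 0 = x"
    using A by (simp add: y_def)
  have "((\<lambda>\<epsilon>. snd c' x + \<epsilon> *\<^sub>R w) has_derivative (\<lambda>\<epsilon>. \<epsilon> *\<^sub>R w)) (at 0)"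
    by (auto intro!: derivative_eq_intros)
  moreover have "((\<lambda>v. snd c (chart_inv c' v)) has_derivative (*v) (jac c' c x)) (at (snd c' x + 0 *\<^sub>R w))"
    using transition_has_derivative[OF c' c] by simp
  ultimately have "((\<lambda>\<epsilon>. snd c (y \<epsilon>)) has_derivative (\<lambda>\<epsilon>. jac c' c x *v (\<epsilon> *\<^sub>R w))) (at 0)"
    unfolding y_def by (rule has_derivative_compose)
  moreover have "((\<lambda>v. g (chart_inv c v)) has_derivative D) (at (snd c (y 0)))"
    using D by (simp add: y0 g_def)
  ultimately have "((\<lambda>\<epsilon>. g (chart_inv c (snd c (y \<epsilon>)))) has_derivative
      (\<lambda>\<epsilon>. D (jac c' c x *v (\<epsilon> *\<^sub>R w)))) (at 0)"
    by (rule has_derivative_compose)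
  moreover have "D (jac c' c x *v (\<epsilon> *\<^sub>R w)) = D (axis k 1) * \<epsilon>" for \<epsilon>
    unfolding w matrix_vector_mult_scaleR
    using linear_scale[OF has_derivative_linear[OF D]]
    by (simp add: matrix_vector_mul_assoc jac_chain[OF c c' c] jac_self[OF c])
  \<comment> \<open>The two transition Jacobians have cancelled.\<close>
  ultimately have "((\<lambda>\<epsilon>. g (chart_inv c (snd c (y \<epsilon>)))) has_field_derivative D (axis k 1)) (at 0)"
    by (simp add: has_field_derivative_def)
  then have "((\<lambda>\<epsilon>. g (y \<epsilon>)) has_field_derivative D (axis k 1)) (at 0)"
    by (rule has_field_derivative_transform_within_open[OF _ \<open>open ?W\<close>])
      (use A in \<open>auto simp: y_def\<close>)
  then have "((\<lambda>\<epsilon>. (1 / \<epsilon>) * (g (y \<epsilon>) - g (y 0))) \<longlongrightarrow> D (axis k 1)) (at 0)"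
    by (simp add: DERIV_def)
  then have "Lim (at 0) (\<lambda>\<epsilon>. (1 / \<epsilon>) * (g (y \<epsilon>) - g (y 0))) = D (axis k 1)"
    by (intro tendsto_Lim) auto
  moreover have "g (y 0) = coord_tensor A c K M x d I J"
    by (simp add: y0 g_def transport_refl[OF coord_tensor_in_tensors_at[OF A(1)]])
  ultimately show ?thesis
    by (simp add: generated_connection_def c'_def[symmetric] w_def[symmetric] Let_def g_def y_def)
qed

lemma path_stays_in_chart:
  assumes "C1_path A J \<gamma>" "t \<in> J" "c \<in> A" "\<gamma> t \<in> fst c"
  shows "\<exists>\<epsilon>>0. \<forall>u\<in>J. dist u t < \<epsilon> \<longrightarrow> \<gamma> u \<in> fst c"
proof -
  have "openin (top_of_set J) (J \<inter> \<gamma> -` fst c)"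
    using assms(1) chart_homeomorphism(1)[OF assms(3)]
    by (intro continuous_openin_preimage_gen) (auto simp: C1_path_def)
  then have "\<forall>u\<in>J \<inter> \<gamma> -` fst c. \<exists>\<epsilon>>0. \<forall>v\<in>J. dist v u < \<epsilon> \<longrightarrow> v \<in> J \<inter> \<gamma> -` fst c"
    unfolding openin_euclidean_subtopology_iff by (rule conjunct2)
  moreover have "t \<in> J \<inter> \<gamma> -` fst c"
    using assms(2,4) by simp
  ultimately show ?thesis
    by blast
qed

lemma C1_path_nontrivial:
  assumes "C1_path A J \<gamma>" "t \<in> J"
  shows "at t within J \<noteq> bot"
proof -
  have "connected J" "interior J \<noteq> {}"
    using assms(1) by (auto simp: C1_path_def is_interval_connected)
  moreover have "J \<noteq> {t}"
    using \<open>interior J \<noteq> {}\<close> by auto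
  ultimately show ?thesis
    using connected_imp_perfect[of J t] assms(2) by (auto simp: trivial_limit_within)
qed

lemma C1_within_vector_derivative:
  assumes "C1_within J T f" "t \<in> T" "at t within J \<noteq> bot"
  shows "(f has_vector_derivative vector_derivative f (at t within J)) (at t within J)"
  using assms unfolding C1_within_def
  by (metis vector_derivative_within)

text \<open>The product rule for \<open>\<Sum> B\<^sup>K\<^sub>M(u) G\<^sub>K\<^sup>M(\<gamma>(u))\<close> with \<open>G\<^sub>K\<^sup>M(y) = L\<^bsub>y\<rightarrow>x\<^esub> E\<^sub>K\<^sup>M(y)\<close> and \<open>x = \<gamma>(t)\<close>:
  at \<open>u = t\<close> the derivative of \<open>G\<^sub>K\<^sup>M\<close> contributes \<open>\<gamma>'\<^sup>k \<nabla>\<^sub>k E\<^sub>K\<^sup>M\<close>, and the factor \<open>G\<^sub>K\<^sup>M(x)\<close> is \<open>E\<^sub>K\<^sup>M(x)\<close>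
  since the transport from \<open>x\<close> to \<open>x\<close> is the identity. This is the Leibniz formula that defines the
  covariant derivative along \<open>\<gamma>\<close>.\<close>

lemma has_vector_derivative_pull_back:
  assumes \<gamma>: "C1_path A J \<gamma>" and t: "t \<in> J" and c: "c \<in> charts_at A (\<gamma> t)"
    and B: "C1_tensor_field_along A J \<gamma> p q B"
  shows "((\<lambda>u. L (\<gamma> u) (\<gamma> t) (B u) d I J') has_vector_derivative
    cov_deriv_along A (generated_connection A L) J \<gamma> p q c B t d I J') (at t within J)"
proof -
  note A = charts_atD[OF c]
  note nontriv = C1_path_nontrivial[OF \<gamma> t]
  define x where "x = \<gamma> t"
  define G where "G = (\<lambda>K M v. L (chart_inv c v) x (coord_tensor A c K M (chart_inv c v)) d I J')"
  let ?T = "{u \<in> J. \<gamma> u \<in> fst c}"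
  have "t \<in> ?T"
    using t A by simp
  have "\<exists>D. (G K M has_derivative D) (at (snd c x))" for K M
    using pulled_back_frame_C1[OF A(1), of x K M d I J'] A(2) unfolding C1_on_def G_def x_def by blast
  then obtain D where D: "\<And>K M. (G K M has_derivative D K M) (at (snd c x))"
    by metis
  have velocity: "(snd c \<circ> \<gamma> has_vector_derivative velocity J \<gamma> c t) (at t within J)"
    unfolding velocity_def using \<gamma> A(1)
    by (intro C1_within_vector_derivative[OF _ \<open>t \<in> ?T\<close> nontriv]) (auto simp: C1_path_def)
  have G': "((\<lambda>u. G K M (snd c (\<gamma> u))) has_vector_derivative
      (\<Sum>k\<in>UNIV. velocity J \<gamma> c t $ k *
        generated_connection A L (coord_vector A c k) (coord_tensor A c K M) x d I J')) (at t within J)" for K M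
  proof -
    have "((G K M \<circ> (snd c \<circ> \<gamma>)) has_vector_derivative D K M (velocity J \<gamma> c t)) (at t within J)"
      by (rule vector_derivative_diff_chain_within[OF velocity has_derivative_at_withinI])
        (use D in \<open>simp add: x_def\<close>)
    moreover have "D K M (velocity J \<gamma> c t) = D K M (\<Sum>k\<in>UNIV. velocity J \<gamma> c t $ k *\<^sub>R axis k 1)"
      using basis_expansion[of "velocity J \<gamma> c t"] by (simp add: scalar_mult_eq_scaleR)
    moreover have "\<dots> = (\<Sum>k\<in>UNIV. velocity J \<gamma> c t $ k * D K M (axis k 1))"
      using has_derivative_linear[OF D] by (simp add: linear_sum linear_scale)
    moreover have "generated_connection A L (coord_vector A c k) (coord_tensor A c K M) x d I J' =
        D K M (axis k 1)" for k
      using c D[of K M] unfolding G_def x_def by (intro generated_connection_coord)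
    ultimately show ?thesis
      by (simp add: o_def)
  qed
  have B': "((\<lambda>u. B u c K M) has_vector_derivative vector_derivative (\<lambda>u. B u c K M) (at t within J))
      (at t within J)" if "length K = p" "length M = q" for K M
    using that B A(1)
    by (intro C1_within_vector_derivative[OF _ \<open>t \<in> ?T\<close> nontriv]) (auto simp: C1_tensor_field_along_def)
  have G0: "G K M (snd c (\<gamma> t)) = coord_tensor A c K M (\<gamma> t) d I J'" for K M
    using A by (simp add: G_def x_def transport_refl[OF coord_tensor_in_tensors_at])
  have deriv: "((\<lambda>u. \<Sum>K | length K = p. \<Sum>M | length M = q. B u c K M * G K M (snd c (\<gamma> u)))
      has_vector_derivative cov_deriv_along A (generated_connection A L) J \<gamma> p q c B t d I J')
      (at t within J)"
  proof -
    have "((\<lambda>u. \<Sum>K | length K = p. \<Sum>M | length M = q. B u c K M * G K M (snd c (\<gamma> u)))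
      has_vector_derivative (\<Sum>K | length K = p. \<Sum>M | length M = q.
        B t c K M * (\<Sum>k\<in>UNIV. velocity J \<gamma> c t $ k *
          generated_connection A L (coord_vector A c k) (coord_tensor A c K M) x d I J') +
        vector_derivative (\<lambda>u. B u c K M) (at t within J) * G K M (snd c (\<gamma> t))))
      (at t within J)"
      by (intro has_vector_derivative_sum has_vector_derivative_mult B' G') auto
    then show ?thesis
      unfolding cov_deriv_along_def x_def by (simp add: G0 add.commute)
  qed
  \<comment> \<open>The expansion in the coordinate tensors of \<open>c\<close> is valid as long as \<open>\<gamma>\<close> stays in this chart.\<close>
  obtain \<epsilon> where \<epsilon>: "\<epsilon> > 0" "\<And>u. u \<in> J \<Longrightarrow> dist u t < \<epsilon> \<Longrightarrow> \<gamma> u \<in> fst c"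
    using path_stays_in_chart[OF \<gamma> t A] by blast
  show ?thesis
  proof (rule has_vector_derivative_transform_within[OF deriv \<epsilon>(1) t])
    fix u assume u: "u \<in> J" "dist u t < \<epsilon>"
    have "c \<in> charts_at A (\<gamma> u)" "B u \<in> tensors_at A (\<gamma> u) p q"
      using \<epsilon>(2)[OF u] u(1) A(1) B by (auto simp: charts_at_def C1_tensor_field_along_def)
    then show "(\<Sum>K | length K = p. \<Sum>M | length M = q. B u c K M * G K M (snd c (\<gamma> u))) =
        L (\<gamma> u) (\<gamma> t) (B u) d I J'"
      using charts_atD[of c "\<gamma> u"] by (subst transport_expansion) (auto simp: G_def x_def)
  qed
qed

section \<open>Parallel fields along a path\<close>

lemma transported_parallel_along:
  assumes \<gamma>: "C1_path A J \<gamma>" and S: "S \<in> tensors_at A (\<gamma> s) p q"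
  shows "parallel_along A (generated_connection A L) J \<gamma> p q (\<lambda>t. L (\<gamma> s) (\<gamma> t) S)"
proof -
  let ?B = "\<lambda>t. L (\<gamma> s) (\<gamma> t) S"
  have "C1_within J {t \<in> J. \<gamma> t \<in> fst c} (\<lambda>t. ?B t c I J')"
    if "c \<in> A" "length I = p" "length J' = q" for c I J'
  proof -
    let ?T = "{t \<in> J. \<gamma> t \<in> fst c}"
    have "C1_within J ?T (snd c \<circ> \<gamma>)"
      using \<gamma> that(1) by (simp add: C1_path_def)
    then have "C1_within J ?T (\<lambda>t. L (\<gamma> s) (chart_inv c ((snd c \<circ> \<gamma>) t)) S c I J')"
      by (rule C1_on_compose_path[OF transported_tensor_C1[OF S that]]) auto
    then show ?thesis
      by (rule C1_within_cong) (use that(1) path_stays_in_chart[OF \<gamma>] in auto)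
  qed
  then have field: "C1_tensor_field_along A J \<gamma> p q ?B"
    using transport_in[OF S] by (simp add: C1_tensor_field_along_def)
  have "cov_deriv_along A (generated_connection A L) J \<gamma> p q c ?B t d I J' = 0"
    if "t \<in> J" "c \<in> charts_at A (\<gamma> t)" for t c d I J'
  proof (rule vector_derivative_unique_within[OF C1_path_nontrivial[OF \<gamma> that(1)]])
    show "((\<lambda>u. L (\<gamma> s) (\<gamma> t) S d I J') has_vector_derivative
        cov_deriv_along A (generated_connection A L) J \<gamma> p q c ?B t d I J') (at t within J)"
      using has_vector_derivative_pull_back[OF \<gamma> that field] by (simp only: transport_flat[OF S])
  qed (rule has_vector_derivative_const)
  with field show ?thesis
    by (simp add: parallel_along_def fun_eq_iff)
qed

text \<open>The derivative of \<open>u \<mapsto> L\<^bsub>\<gamma>(u)\<rightarrow>\<gamma>(s)\<^esub> B\<^sub>u\<close> at \<open>r\<close> is computed after factoring the transport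
  through the point \<open>\<gamma>(r)\<close>: the first factor has derivative \<open>0\<close> at \<open>r\<close> because \<open>B\<close> is parallel, and
  the second one is linear and independent of \<open>u\<close>.\<close>

lemma parallel_along_eq_transport:
  assumes \<gamma>: "C1_path A J \<gamma>" and "s \<in> J" "t \<in> J"
    and B: "parallel_along A (generated_connection A L) J \<gamma> p q B"
  shows "B t = L (\<gamma> s) (\<gamma> t) (B s)"
proof -
  have field: "C1_tensor_field_along A J \<gamma> p q B"
    and B_in: "\<And>u. u \<in> J \<Longrightarrow> B u \<in> tensors_at A (\<gamma> u) p q"
    using B by (auto simp: parallel_along_def C1_tensor_field_along_def)
  have "L (\<gamma> t) (\<gamma> s) (B t) d I J' = L (\<gamma> s) (\<gamma> s) (B s) d I J'" for d I J'
  proof -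
    let ?F = "\<lambda>u. L (\<gamma> u) (\<gamma> s) (B u) d I J'"
    have "(?F has_vector_derivative 0) (at r within J)" if r: "r \<in> J" for r
    proof -
      obtain c where c: "c \<in> charts_at A (\<gamma> r)"
        using chart_at_exists by blast
      have "((\<lambda>u. L (\<gamma> u) (\<gamma> r) (B u) c K M) has_vector_derivative 0) (at r within J)" for K M
        using has_vector_derivative_pull_back[OF \<gamma> r c field, of c K M] B r c
        by (simp add: parallel_along_def)
      then have "((\<lambda>u. \<Sum>K | length K = p. \<Sum>M | length M = q.
          L (\<gamma> u) (\<gamma> r) (B u) c K M * L (\<gamma> r) (\<gamma> s) (coord_tensor A c K M (\<gamma> r)) d I J')
          has_vector_derivative (\<Sum>K | length K = p. \<Sum>M::'n list | length M = q.
          0 * L (\<gamma> r) (\<gamma> s) (coord_tensor A c K M (\<gamma> r)) d I J')) (at r within J)"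
        by (intro has_vector_derivative_sum has_vector_derivative_mult_left)
      then have "((\<lambda>u. \<Sum>K | length K = p. \<Sum>M | length M = q.
          L (\<gamma> u) (\<gamma> r) (B u) c K M * L (\<gamma> r) (\<gamma> s) (coord_tensor A c K M (\<gamma> r)) d I J')
          has_vector_derivative 0) (at r within J)"
        by simp
      then show ?thesis
      proof (rule has_vector_derivative_transform_within[OF _ zero_less_one r])
        fix u assume u: "u \<in> J"
        show "(\<Sum>K | length K = p. \<Sum>M | length M = q.
          L (\<gamma> u) (\<gamma> r) (B u) c K M * L (\<gamma> r) (\<gamma> s) (coord_tensor A c K M (\<gamma> r)) d I J') = ?F u"
          unfolding transport_expansion[OF transport_in[OF B_in[OF u]] c, symmetric]
            transport_flat[OF B_in[OF u]] ..
      qed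
    qed
    then have "\<exists>a. \<forall>u\<in>J. ?F u = a"
      using \<gamma> by (intro has_derivative_zero_constant)
        (auto simp: C1_path_def is_interval_convex has_vector_derivative_def)
    then show ?thesis
      using assms(2,3) by metis
  qed
  then have "L (\<gamma> t) (\<gamma> s) (B t) = B s"
    using transport_refl[OF B_in[OF assms(2)]] by (intro ext) simp
  then show ?thesis
    using transport_flat[OF B_in[OF assms(3)], of "\<gamma> s" "\<gamma> t"] transport_refl[OF B_in[OF assms(3)]]
    by simp
qed

end

theorem proposition3p6:
  fixes A :: "('a::t2_space, 'n::finite) chart set"
    and L :: "'a \<Rightarrow> 'a \<Rightarrow> ('a, 'n) tensor \<Rightarrow> ('a, 'n) tensor"
    and \<gamma> :: "real \<Rightarrow> 'a" and J :: "real set" and s t :: real and p q :: nat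
  assumes "C1_manifold A"
    and "flat_linear_transport A L"
    and "C1_transport A L"
    and "C1_path A J \<gamma>" and "s \<in> J" and "t \<in> J"
  shows "\<forall>S\<^sub>0 \<in> tensors_at A (\<gamma> s) p q.
    parallel_transport A (generated_connection A L) J \<gamma> p q s t S\<^sub>0 = L (\<gamma> s) (\<gamma> t) S\<^sub>0"
proof
  interpret C1_flat_transport A L
    using assms(1-3) by unfold_locales
  fix S\<^sub>0 assume S\<^sub>0: "S\<^sub>0 \<in> tensors_at A (\<gamma> s) p q"
  show "parallel_transport A (generated_connection A L) J \<gamma> p q s t S\<^sub>0 = L (\<gamma> s) (\<gamma> t) S\<^sub>0"
    unfolding parallel_transport_def
  proof (rule the_equality)
    show "\<exists>B. parallel_along A (generated_connection A L) J \<gamma> p q B \<and> B s = S\<^sub>0 \<and>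
        L (\<gamma> s) (\<gamma> t) S\<^sub>0 = B t"
      using transported_parallel_along[OF assms(4) S\<^sub>0] transport_refl[OF S\<^sub>0] by blast
  next
    fix S assume "\<exists>B. parallel_along A (generated_connection A L) J \<gamma> p q B \<and> B s = S\<^sub>0 \<and> S = B t"
    then show "S = L (\<gamma> s) (\<gamma> t) S\<^sub>0"
      using parallel_along_eq_transport[OF assms(4-6)] by blast
  qed
qed

end
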